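(* The set $$\mathcal{S}_c(\mathbb{R}_+) := \{f \in \mathcal{S}(\mathbb{R}_+) : \operatorname{supp}(f) \text{ is compact}\}$$ is dense in $\mathcal{S}(\mathbb{R}_+)$.
   Context: $\mathbb{R}_+=(0,\infty)$, $\mathbb{N}_0=\{0,1,2,\ldots\}$. $\mathcal{S}(\mathbb{R}_+)$ is the real vector space of all $f\in C^\infty(\mathbb{R}_+)$ (real-valued) such that for all $\alpha\in\mathbb{Z}$ and $\beta\in\mathbb{N}_0$ one has $p_{\alpha,\beta}(f) := \sup_{x\in\mathbb{R}_+} |x^\alpha f^{(\beta)}(x)| < \infty$. It carries the locally convex (metrizable) topology generated by the seminorms $(p_{\alpha,\beta})_{\alpha\in\mathbb{Z},\beta\in\mathbb{N}_0}$; thus $f_m\to f$ if and only if $p_{\alpha,\beta}(f_m-f)\to 0$ for all $\alpha\in\mathbb{Z},\beta\in\mathbb{N}_0$. The support $\operatorname{supp}(f)$ is the closure in $\mathbb{R}_+$ of $\{x\in\mathbb{R}_+: f(x)\neq 0\}$. *)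

theory Defs
  imports "HOL-Analysis.Analysis"
begin

text \<open>A function on \<open>(0,\<infinity>)\<close> is represented by its extension by \<open>0\<close> to a total function
  \<open>real \<Rightarrow> real\<close>. This only makes the representation unique and the vector space operations
  pointwise: regularity, seminorms and support refer to points \<open>x > 0\<close> exclusively, and no
  regularity is required at \<open>0\<close>.\<close>

definition smooth_Rplus :: "(real \<Rightarrow> real) \<Rightarrow> bool" where
  "smooth_Rplus f \<longleftrightarrow> (\<forall>n::nat. \<forall>x>0. (deriv ^^ n) f field_differentiable at x)"

text \<open>The supremum is taken in \<^typ>\<open>real\<close>, hence is meaningful only if the range is bounded above;
  this is part of the definition of \<open>Schwartz_Rplus\<close> below.\<close>

definition schwartz_seminorm :: "int \<Rightarrow> nat \<Rightarrow> (real \<Rightarrow> real) \<Rightarrow> real" where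
  "schwartz_seminorm \<alpha> \<beta> f = (SUP x\<in>{0<..}. \<bar>x powi \<alpha> * (deriv ^^ \<beta>) f x\<bar>)"

definition Schwartz_Rplus :: "(real \<Rightarrow> real) set" where
  "Schwartz_Rplus = {f. (\<forall>x\<le>0. f x = 0) \<and> smooth_Rplus f \<and>
     (\<forall>(\<alpha>::int) (\<beta>::nat). bdd_above ((\<lambda>x. \<bar>x powi \<alpha> * (deriv ^^ \<beta>) f x\<bar>) ` {0<..}))}"

text \<open>The topology generated by the seminorms: the open semiballs form a subbase.\<close>

definition Schwartz_Rplus_topology :: "(real \<Rightarrow> real) topology" where
  "Schwartz_Rplus_topology = topology_generated_by
     {{g \<in> Schwartz_Rplus. schwartz_seminorm \<alpha> \<beta> (\<lambda>x. g x - f x) < e} | \<alpha> \<beta> f e.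
        f \<in> Schwartz_Rplus \<and> e > 0}"

lemma topspace_Schwartz_Rplus_topology [simp]:
  "topspace Schwartz_Rplus_topology = Schwartz_Rplus"
proof (rule equalityI; rule subsetI)
  fix f assume "f \<in> topspace Schwartz_Rplus_topology"
  then show "f \<in> Schwartz_Rplus"
    unfolding Schwartz_Rplus_topology_def topology_generated_by_topspace by auto
next
  fix f assume f: "f \<in> Schwartz_Rplus"
  define c where "c = schwartz_seminorm 0 0 (\<lambda>x. f x - f x)"
  let ?U = "{g \<in> Schwartz_Rplus. schwartz_seminorm 0 0 (\<lambda>x. g x - f x) < \<bar>c\<bar> + 1}"
  have "c < \<bar>c\<bar> + 1" by linarith
  then have "f \<in> ?U"
    using f unfolding c_def by (intro CollectI conjI)
  moreover have "?U \<in> {{g \<in> Schwartz_Rplus. schwartz_seminorm \<alpha> \<beta> (\<lambda>x. g x - f x) < e} | \<alpha> \<beta> f e.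
        f \<in> Schwartz_Rplus \<and> e > 0}"
    by (intro CollectI exI[of _ 0] exI[of _ f] exI[of _ "\<bar>c\<bar> + 1"] conjI refl f) linarith
  ultimately show "f \<in> topspace Schwartz_Rplus_topology"
    unfolding Schwartz_Rplus_topology_def topology_generated_by_topspace by (rule UnionI[rotated])
qed

definition supp_Rplus :: "(real \<Rightarrow> real) \<Rightarrow> real set" where
  "supp_Rplus f = top_of_set {0<..} closure_of {x \<in> {0<..}. f x \<noteq> 0}"

definition Schwartz_c_Rplus :: "(real \<Rightarrow> real) set" where
  "Schwartz_c_Rplus = {f \<in> Schwartz_Rplus. compact (supp_Rplus f)}"

end

theory Submission
  imports Defs
begin

text \<open>
  A Schwartz function \<open>f\<close> on \<open>(0,\<infinity>)\<close> is approximated by the truncations \<open>\<eta>\<^sub>r f\<close> as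
  \<open>r \<rightarrow> \<infinity>\<close>. With a smooth step \<open>s\<close> from \<open>0\<close> (on \<open>t \<le> 1\<close>) to \<open>1\<close> (on \<open>t \<ge> 2\<close>), the cutoff
  \<open>\<eta>\<^sub>r(x) = s(r x) (1 - s(x / r))\<close> lives on \<open>[1/r, 2r]\<close> and is \<open>1\<close> on \<open>(2/r, r)\<close>.

  The \<open>k\<close>-th derivative of the inner factor \<open>s(r x)\<close> grows like \<open>r\<^sup>k\<close>, so uniform bounds on the
  derivatives fail. The quantity \<open>x\<^sup>k u\<^sup>(\<^sup>k\<^sup>)(x)\<close>, however, is invariant under
  dilations of the argument, and by the Leibniz rule its boundedness passes to products. Hence
  \<open>\<bar>x\<^sup>k \<eta>\<^sub>r\<^sup>(\<^sup>k\<^sup>)(x)\<bar> \<le> C\<^sub>k\<close> with constants independent of \<open>r\<close>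
  (\<open>cutoff_family_exists\<close>). Loss of powers of \<open>x\<close> is harmless, because Schwartz functions on
  \<open>(0,\<infinity>)\<close> have seminorms for all integer powers.

  For the error \<open>w f\<close> with \<open>w = \<eta>\<^sub>r - 1\<close>, note that \<open>w\<close> is nonzero only where
  \<open>x \<le> 2/r\<close> or \<open>x \<ge> r\<close>, and there \<open>1 \<le> (2/r) (x + 1/x)\<close>. Trading one power of \<open>x\<close> up
  or down in the Leibniz expansion thus gains the factor \<open>2/r\<close>, so each seminorm of the error is
  \<open>O(1/r)\<close> (\<open>seminorm_mult_le_if_vanishes_in_middle\<close>). An induction over the topology generated by
  the semiballs turns this into convergence in the Schwartz topology
  (\<open>eventually_in_open_Schwartz_Rplus\<close>).

  The step is a normalised antiderivative of a bump built from \<open>exp (-1/x)\<close>, whose smoothness at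
  \<open>0\<close> is shown within the family \<open>p(1/x) exp (-1/x)\<close>, \<open>p\<close> a polynomial, which is closed under
  differentiation.
\<close>

section \<open>Smooth functions and their higher derivatives\<close>

definition smooth_on :: "real set \<Rightarrow> (real \<Rightarrow> real) \<Rightarrow> bool" where
  "smooth_on S f \<longleftrightarrow> (\<forall>n. \<forall>x\<in>S. (deriv ^^ n) f field_differentiable at x)"

lemma smooth_Rplus_iff: "smooth_Rplus f \<longleftrightarrow> smooth_on {0<..} f"
  unfolding smooth_Rplus_def smooth_on_def by auto

lemma smooth_on_DERIV:
  assumes "smooth_on S f" "x \<in> S"
  shows "((deriv ^^ n) f has_real_derivative (deriv ^^ Suc n) f x) (at x)"
  using assms unfolding smooth_on_def by (simp add: DERIV_deriv_iff_field_differentiable)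

lemma smooth_on_subset: "smooth_on S f \<Longrightarrow> T \<subseteq> S \<Longrightarrow> smooth_on T f"
  unfolding smooth_on_def by blast

text \<open>Higher derivatives are computed by guessing the whole sequence at once: any sequence of
  functions starting at \<open>f\<close>, each the derivative of its predecessor, is the sequence of higher
  derivatives. Openness lets the derivative at a point see only values inside \<open>S\<close>. All closure
  properties of smooth functions below are instances.\<close>
lemma
  fixes D :: "nat \<Rightarrow> real \<Rightarrow> real"
  assumes S: "open S" and f: "\<And>x. x \<in> S \<Longrightarrow> f x = D 0 x"
    and D: "\<And>n x. x \<in> S \<Longrightarrow> (D n has_real_derivative D (Suc n) x) (at x)"
  shows higher_deriv_unique: "x \<in> S \<Longrightarrow> (deriv ^^ n) f x = D n x"
    and smooth_onI: "smooth_on S f"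
proof -
  have main: "(\<forall>x\<in>S. (deriv ^^ n) f x = D n x) \<and>
      (\<forall>x\<in>S. ((deriv ^^ n) f has_real_derivative D (Suc n) x) (at x))" for n
  proof (induction n)
    case 0
    have "(f has_real_derivative D (Suc 0) x) (at x)" if "x \<in> S" for x
      using D[OF that, of 0] by (rule DERIV_cong_ev[THEN iffD1, rotated -1])
        (use S f that in \<open>auto intro!: eventually_nhds_in_open elim!: eventually_mono
            simp: eventually_nhds\<close>)
    then show ?case using f by simp
  next
    case (Suc n)
    have eq: "(deriv ^^ Suc n) f x = D (Suc n) x" if "x \<in> S" for x
      using Suc that by (auto intro: DERIV_imp_deriv)
    have "((deriv ^^ Suc n) f has_real_derivative D (Suc (Suc n)) x) (at x)" if "x \<in> S" for x
    proof (rule has_field_derivative_transform_within_open[OF D[OF that] S that])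
      fix y assume "y \<in> S" then show "D (Suc n) y = (deriv ^^ Suc n) f y" using eq by simp
    qed
    then show ?case using eq by blast
  qed
  show "x \<in> S \<Longrightarrow> (deriv ^^ n) f x = D n x" using main by blast
  show "smooth_on S f"
    using main unfolding smooth_on_def field_differentiable_def by blast
qed

lemma
  assumes S: "open S" and f: "smooth_on S f" and g: "smooth_on S g"
  shows smooth_on_diff: "smooth_on S (\<lambda>x. f x - g x)"
    and higher_deriv_diff:
      "x \<in> S \<Longrightarrow> (deriv ^^ n) (\<lambda>x. f x - g x) x = (deriv ^^ n) f x - (deriv ^^ n) g x"
proof -
  let ?D = "\<lambda>n x. (deriv ^^ n) f x - (deriv ^^ n) g x"
  have D: "(?D n has_real_derivative ?D (Suc n) x) (at x)" if "x \<in> S" for n x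
    by (rule DERIV_diff[OF smooth_on_DERIV[OF f that] smooth_on_DERIV[OF g that]])
  show "smooth_on S (\<lambda>x. f x - g x)"
    by (rule smooth_onI[OF S, of _ ?D]) (use D in auto)
  show "x \<in> S \<Longrightarrow> (deriv ^^ n) (\<lambda>x. f x - g x) x = ?D n x"
    by (rule higher_deriv_unique[OF S, of _ ?D]) (use D in auto)
qed

lemma
  shows smooth_on_const: "smooth_on UNIV (\<lambda>x. c)"
    and higher_deriv_const: "(deriv ^^ n) (\<lambda>x. c) x = (if n = 0 then c else 0 :: real)"
  using smooth_onI[OF open_UNIV, of "\<lambda>x. c" "\<lambda>n x. if n = 0 then c else 0"]
    higher_deriv_unique[OF open_UNIV, of "\<lambda>x. c" "\<lambda>n x. if n = 0 then c else 0"]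
  by auto

lemma
  assumes f: "smooth_on UNIV f"
  shows smooth_on_affine: "smooth_on UNIV (\<lambda>x. f (c * x + d))"
    and higher_deriv_affine:
      "(deriv ^^ n) (\<lambda>x. f (c * x + d)) x = c ^ n * (deriv ^^ n) f (c * x + d)"
proof -
  let ?D = "\<lambda>n x. c ^ n * (deriv ^^ n) f (c * x + d)"
  have D: "(?D n has_real_derivative ?D (Suc n) x) (at x)" for n x
  proof -
    have "((\<lambda>x. (deriv ^^ n) f (c * x + d)) has_real_derivative
        (deriv ^^ Suc n) f (c * x + d) * c) (at x)"
      by (rule DERIV_chain2[OF smooth_on_DERIV[OF f]]) (auto intro!: derivative_eq_intros)
    from DERIV_cmult[OF this, of "c ^ n"] show ?thesis by (simp add: mult_ac)
  qed
  show "smooth_on UNIV (\<lambda>x. f (c * x + d))"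
    by (rule smooth_onI[of _ _ ?D]) (use D in auto)
  show "(deriv ^^ n) (\<lambda>x. f (c * x + d)) x = ?D n x"
    by (rule higher_deriv_unique[of UNIV _ ?D]) (use D in auto)
qed

text \<open>Pascal's rule, in the form that is the induction step of the Leibniz rule.\<close>
lemma Leibniz_sum_step:
  fixes a b :: "nat \<Rightarrow> real"
  shows "(\<Sum>k\<le>n. (n choose k) * (a (Suc k) * b (n - k) + a k * b (Suc (n - k))))
    = (\<Sum>k\<le>Suc n. (Suc n choose k) * (a k * b (Suc n - k)))"
proof -
  have "(\<Sum>k\<le>Suc n. (Suc n choose k) * (a k * b (Suc n - k)))
      = a 0 * b (Suc n) + (\<Sum>k\<le>n. (n choose k) * (a (Suc k) * b (n - k)))
        + (\<Sum>k\<le>n. (n choose Suc k) * (a (Suc k) * b (n - k)))"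
    by (subst sum.atMost_Suc_shift) (simp add: sum.distrib algebra_simps)
  moreover have "(\<Sum>k\<le>n. (n choose Suc k) * (a (Suc k) * b (n - k))) + a 0 * b (Suc n)
      = (\<Sum>k\<le>Suc n. (n choose k) * (a k * b (Suc n - k)))"
    by (subst sum.atMost_Suc_shift) simp
  moreover have "(\<Sum>k\<le>Suc n. (n choose k) * (a k * b (Suc n - k)))
      = (\<Sum>k\<le>n. (n choose k) * (a k * b (Suc (n - k))))"
    by (simp add: Suc_diff_le)
  ultimately show ?thesis by (simp add: sum.distrib algebra_simps)
qed

lemma
  assumes S: "open S" and f: "smooth_on S f" and g: "smooth_on S g"
  shows smooth_on_mult: "smooth_on S (\<lambda>x. f x * g x)"
    and higher_deriv_mult_Leibniz: "x \<in> S \<Longrightarrow> (deriv ^^ n) (\<lambda>x. f x * g x) x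
      = (\<Sum>k\<le>n. (n choose k) * ((deriv ^^ k) f x * (deriv ^^ (n - k)) g x))"
proof -
  let ?D = "\<lambda>n x. \<Sum>k\<le>n. (n choose k) * ((deriv ^^ k) f x * (deriv ^^ (n - k)) g x)"
  have D: "(?D n has_real_derivative ?D (Suc n) x) (at x)" if "x \<in> S" for n x
  proof -
    have "((\<lambda>x. (deriv ^^ k) f x * (deriv ^^ l) g x) has_real_derivative
        (deriv ^^ Suc k) f x * (deriv ^^ l) g x + (deriv ^^ k) f x * (deriv ^^ Suc l) g x) (at x)"
      for k l
      using DERIV_mult[OF smooth_on_DERIV[OF f that, of k] smooth_on_DERIV[OF g that, of l]]
      by (simp only: mult.commute[of _ "(deriv ^^ k) f x"])
    then have "(?D n has_real_derivative (\<Sum>k\<le>n. (n choose k) *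
        ((deriv ^^ Suc k) f x * (deriv ^^ (n - k)) g x
          + (deriv ^^ k) f x * (deriv ^^ Suc (n - k)) g x))) (at x)"
      by (intro DERIV_sum DERIV_cmult)
    then show ?thesis
      using Leibniz_sum_step[of n "\<lambda>k. (deriv ^^ k) f x" "\<lambda>k. (deriv ^^ k) g x"] by (simp only:)
  qed
  show "smooth_on S (\<lambda>x. f x * g x)"
    by (rule smooth_onI[OF S, of _ ?D]) (use D in auto)
  show "x \<in> S \<Longrightarrow> (deriv ^^ n) (\<lambda>x. f x * g x) x = ?D n x"
    by (rule higher_deriv_unique[OF S, of _ ?D]) (use D in auto)
qed

lemma higher_deriv_locally_const:
  assumes "open S" "\<And>x. x \<in> S \<Longrightarrow> f x = (c::real)" "x \<in> S"
  shows "(deriv ^^ n) f x = (if n = 0 then c else 0)"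
  using higher_deriv_unique[OF assms(1), of f "\<lambda>n x. if n = 0 then c else 0" x n] assms by auto

section \<open>A smooth step function\<close>

text \<open>A family rather than the single function \<open>exp (-1/x)\<close>, so that every derivative is again of
  this form and one argument at the origin covers all orders.\<close>
definition flat_exp :: "real poly \<Rightarrow> real \<Rightarrow> real" where
  "flat_exp p x = (if x > 0 then poly p (1 / x) * exp (- (1 / x)) else 0)"

lemma poly_times_exp_minus_tendsto_0:
  fixes p :: "real poly"
  shows "((\<lambda>y. poly p y * exp (- y)) \<longlongrightarrow> 0) at_top"
proof -
  have "((\<lambda>y. \<Sum>i\<le>degree p. coeff p i * (y ^ i / exp y)) \<longlongrightarrow> (\<Sum>i\<le>degree p. coeff p i * 0)) at_top"
    by (intro tendsto_sum tendsto_mult tendsto_const tendsto_power_div_exp_0)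
  then show ?thesis
    by (simp add: poly_altdef exp_minus sum_distrib_left divide_inverse mult_ac)
qed

lemma flat_exp_tendsto_0: "(flat_exp p \<longlongrightarrow> 0) (at 0)"
proof -
  have "((\<lambda>x. poly p (inverse x) * exp (- inverse x)) \<longlongrightarrow> 0) (at_right 0)"
    by (rule filterlim_compose[OF poly_times_exp_minus_tendsto_0 filterlim_inverse_at_top_right])
  then have "(flat_exp p \<longlongrightarrow> 0) (at_right 0)"
    by (rule tendsto_cong[THEN iffD1, rotated])
      (auto simp: flat_exp_def eventually_at_filter inverse_eq_divide)
  moreover have "(flat_exp p \<longlongrightarrow> 0) (at_left 0)"
    by (rule tendsto_eventually) (auto simp: flat_exp_def eventually_at_filter)
  ultimately show ?thesis by (simp add: filterlim_split_at)
qed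

text \<open>For \<open>x > 0\<close> this is the chain rule with \<open>(1/x)' = -(1/x)\<^sup>2\<close>; at the origin the difference
  quotient of a member of the family is the member with polynomial \<open>X p\<close>, which tends to \<open>0\<close>.\<close>
lemma flat_exp_DERIV:
  "(flat_exp p has_real_derivative flat_exp ([:0, 0, 1:] * (p - pderiv p)) x) (at x)"
proof -
  consider "x > 0" | "x < 0" | "x = 0" by linarith
  then show ?thesis
  proof cases
    case 1
    have "((\<lambda>x. poly p (1 / x) * exp (- (1 / x))) has_real_derivative
        flat_exp ([:0, 0, 1:] * (p - pderiv p)) x) (at x)"
      using 1 by (auto intro!: derivative_eq_intros DERIV_chain2[OF poly_DERIV]
          simp: flat_exp_def field_simps power2_eq_square)
    then show ?thesis
      by (rule has_field_derivative_transform_within_open[of _ _ _ "{0<..}"])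
        (use 1 in \<open>auto simp: flat_exp_def\<close>)
  next
    case 2
    have "((\<lambda>x. 0) has_real_derivative flat_exp ([:0, 0, 1:] * (p - pderiv p)) x) (at x)"
      using 2 by (simp add: flat_exp_def)
    then show ?thesis
      by (rule has_field_derivative_transform_within_open[of _ _ _ "{..<0}"])
        (use 2 in \<open>auto simp: flat_exp_def\<close>)
  next
    case 3
    have "(flat_exp p (0 + h) - flat_exp p 0) / h = flat_exp ([:0, 1:] * p) h" for h
      by (simp add: flat_exp_def)
    moreover have "flat_exp ([:0, 0, 1:] * (p - pderiv p)) 0 = 0"
      by (simp add: flat_exp_def)
    ultimately show ?thesis
      unfolding 3 DERIV_def by (simp only: flat_exp_tendsto_0)
  qed
qed

lemma smooth_on_flat_exp: "smooth_on UNIV (flat_exp p)"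
  by (rule smooth_onI[of _ _ "\<lambda>n. flat_exp (((\<lambda>q. [:0, 0, 1:] * (q - pderiv q)) ^^ n) p)"])
    (use flat_exp_DERIV in auto)

lemma smooth_bump_exists:
  obtains b :: "real \<Rightarrow> real"
  where "smooth_on UNIV b" "\<And>t. t \<in> {1<..<2} \<Longrightarrow> b t > 0" "\<And>t. t \<notin> {1<..<2} \<Longrightarrow> b t = 0"
proof
  \<comment> \<open>The arguments \<open>t - 1\<close> and \<open>2 - t\<close> are written in the shape \<open>c t + d\<close> of \<open>smooth_on_affine\<close>.\<close>
  let ?b = "\<lambda>t. flat_exp 1 (1 * t + (- 1)) * flat_exp 1 ((- 1) * t + 2)"
  show "smooth_on UNIV ?b"
    by (intro smooth_on_mult smooth_on_affine smooth_on_flat_exp open_UNIV)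
  show "\<And>t. t \<in> {1<..<2} \<Longrightarrow> ?b t > 0" "\<And>t. t \<notin> {1<..<2} \<Longrightarrow> ?b t = 0"
    by (auto simp: flat_exp_def)
qed

text \<open>Integrating the bump gives a function that is constant on both sides of \<open>(1, 2)\<close> and strictly
  larger on the right, so it can be normalised to run from \<open>0\<close> to \<open>1\<close>.\<close>
lemma smooth_step_exists:
  obtains s :: "real \<Rightarrow> real"
  where "smooth_on UNIV s" "\<And>t. t \<le> 1 \<Longrightarrow> s t = 0" "\<And>t. t \<ge> 2 \<Longrightarrow> s t = 1"
proof -
  obtain b :: "real \<Rightarrow> real" where b: "smooth_on UNIV b"
    and pos: "\<And>t. t \<in> {1<..<2} \<Longrightarrow> b t > 0" and zero: "\<And>t. t \<notin> {1<..<2} \<Longrightarrow> b t = 0"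
    by (rule smooth_bump_exists) blast
  have "isCont b x" for x
    using smooth_on_DERIV[OF b, of x 0] DERIV_isCont by auto
  then obtain F where F: "\<And>x. (F has_real_derivative b x) (at x)"
    using einterval_antiderivative[of "-\<infinity>" "\<infinity>" b]
    by (auto simp: has_real_derivative_iff_has_vector_derivative)
  define c where "c = F 2 - F 1"
  have "F 1 < F 2"
    by (rule DERIV_pos_imp_increasing_open[of 1 2])
      (use F pos in \<open>auto intro!: DERIV_continuous_on[of _ _ b] intro: DERIV_subset\<close>)
  then have c: "c > 0" by (simp add: c_def)
  let ?s = "\<lambda>t. (F t - F 1) / c"
  let ?D = "\<lambda>n. case n of 0 \<Rightarrow> ?s | Suc k \<Rightarrow> (\<lambda>t. (deriv ^^ k) b t / c)"
  have smooth: "smooth_on UNIV ?s"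
  proof (rule smooth_onI[of _ _ ?D])
    fix n x
    show "(?D n has_real_derivative ?D (Suc n) x) (at x)"
    proof (cases n)
      case 0
      then show ?thesis using c F by (auto intro!: derivative_eq_intros)
    next
      case (Suc k)
      then show ?thesis using DERIV_cdivide[OF smooth_on_DERIV[OF b, of x k], of c] by simp
    qed
  qed auto
  have F_const: "F u = F v" if uv: "u \<le> v" "\<And>x. x \<in> {u<..<v} \<Longrightarrow> x \<notin> {1<..<2}" for u v
  proof (cases "u = v")
    case False
    have "continuous_on {u..v} F"
      by (intro DERIV_continuous_on[of _ F b] DERIV_subset[OF F]) auto
    moreover have "(F has_real_derivative 0) (at x)" if "u < x" "x < v" for x
      using F[of x] zero[OF uv(2), of x] that by simp
    ultimately show ?thesis
      using DERIV_isconst_end[of u v F] False uv(1) by simp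
  qed simp
  show ?thesis
  proof (rule that[OF smooth])
    show "?s t = 0" if "t \<le> 1" for t
    proof -
      have "F t = F 1" using that by (intro F_const) auto
      then show ?thesis by simp
    qed
    show "?s t = 1" if "t \<ge> 2" for t
    proof -
      have "F 2 = F t" using that by (intro F_const) auto
      then show ?thesis using c by (simp add: c_def)
    qed
  qed
qed

section \<open>Scale-invariant derivative bounds\<close>

text \<open>The weight \<open>x ^ k\<close> matches the order of differentiation, which makes the bound invariant
  under dilations \<open>x \<mapsto> c x\<close> with the same constants.\<close>
definition scale_bounded :: "(nat \<Rightarrow> real) \<Rightarrow> (real \<Rightarrow> real) \<Rightarrow> bool" where
  "scale_bounded C u \<longleftrightarrow> smooth_on {0<..} u \<and> (\<forall>k. \<forall>x>0. \<bar>x ^ k * (deriv ^^ k) u x\<bar> \<le> C k)"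

lemma scale_bounded_const: "scale_bounded (\<lambda>k. \<bar>c\<bar>) (\<lambda>x. c)"
  unfolding scale_bounded_def
  using smooth_on_subset[OF smooth_on_const] by (auto simp: higher_deriv_const)

lemma scale_bounded_diff:
  fixes C E :: "nat \<Rightarrow> real"
  assumes "scale_bounded C u" "scale_bounded E v"
  shows "scale_bounded (\<lambda>k. C k + E k) (\<lambda>x. u x - v x)"
  unfolding scale_bounded_def
proof (intro conjI allI impI)
  have u: "smooth_on {0<..} u" and v: "smooth_on {0<..} v"
    using assms by (auto simp: scale_bounded_def)
  show "smooth_on {0<..} (\<lambda>x. u x - v x)" using u v by (simp add: smooth_on_diff)
  fix k and x :: real assume x: "x > 0"
  have "\<bar>x ^ k * (deriv ^^ k) u x\<bar> \<le> C k" "\<bar>x ^ k * (deriv ^^ k) v x\<bar> \<le> E k"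
    using assms x by (auto simp: scale_bounded_def)
  then show "\<bar>x ^ k * (deriv ^^ k) (\<lambda>x. u x - v x) x\<bar> \<le> C k + E k"
    using higher_deriv_diff[OF _ u v, of x k] x by (simp add: right_diff_distrib)
qed

text \<open>In each Leibniz term \<open>x\<^sup>\<alpha>\<close> is split as \<open>x\<^sup>k x\<^sup>\<alpha>\<^sup>-\<^sup>k\<close>, giving \<open>k\<close> powers to the
  factor that is differentiated \<open>k\<close> times. This one estimate serves for products of scale-bounded
  functions, for membership of truncations in the Schwartz space and for the truncation error.\<close>
lemma Leibniz_powi_bound:
  fixes M :: "nat \<Rightarrow> real"
  assumes u: "smooth_on {0<..} u" and f: "smooth_on {0<..} f" and x: "x > 0"
    and b: "\<And>k. k \<le> \<beta> \<Longrightarrow> (\<bar>x ^ k * (deriv ^^ k) u x\<bar>) * (\<bar>x powi (\<alpha> - int k) * (deriv ^^ (\<beta> - k)) f x\<bar>) \<le> M k"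
  shows "\<bar>x powi \<alpha> * (deriv ^^ \<beta>) (\<lambda>x. u x * f x) x\<bar> \<le> (\<Sum>k\<le>\<beta>. (\<beta> choose k) * M k)"
proof -
  have pw: "x powi \<alpha> = x ^ k * x powi (\<alpha> - int k)" for k
    using x power_int_add[of x "int k" "\<alpha> - int k"] by simp
  have "x powi \<alpha> * (deriv ^^ \<beta>) (\<lambda>x. u x * f x) x
      = (\<Sum>k\<le>\<beta>. x powi \<alpha> * ((\<beta> choose k) * ((deriv ^^ k) u x * (deriv ^^ (\<beta> - k)) f x)))"
    using higher_deriv_mult_Leibniz[OF _ u f, of x \<beta>] x by (simp add: sum_distrib_left)
  also have "\<dots> = (\<Sum>k\<le>\<beta>. (\<beta> choose k) *
      ((x ^ k * (deriv ^^ k) u x) * (x powi (\<alpha> - int k) * (deriv ^^ (\<beta> - k)) f x)))"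
  proof (rule sum.cong[OF refl])
    fix k
    show "x powi \<alpha> * ((\<beta> choose k) * ((deriv ^^ k) u x * (deriv ^^ (\<beta> - k)) f x))
      = (\<beta> choose k) * ((x ^ k * (deriv ^^ k) u x) * (x powi (\<alpha> - int k) * (deriv ^^ (\<beta> - k)) f x))"
      by (subst pw[of k]) (simp only: mult_ac)
  qed
  also have "\<bar>\<dots>\<bar> \<le> (\<Sum>k\<le>\<beta>. (\<beta> choose k) * M k)"
  proof (rule order.trans[OF sum_abs sum_mono])
    fix k assume "k \<in> {..\<beta>}"
    then have "\<bar>(x ^ k * (deriv ^^ k) u x) * (x powi (\<alpha> - int k) * (deriv ^^ (\<beta> - k)) f x)\<bar> \<le> M k"
      using b[of k] by (simp only: abs_mult[of "x ^ k * _"] atMost_iff)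
    then have "(\<beta> choose k) * \<bar>(x ^ k * (deriv ^^ k) u x) * (x powi (\<alpha> - int k) * (deriv ^^ (\<beta> - k)) f x)\<bar>
        \<le> (\<beta> choose k) * M k"
      by (rule mult_left_mono) simp
    then show "\<bar>(\<beta> choose k) * ((x ^ k * (deriv ^^ k) u x) * (x powi (\<alpha> - int k) * (deriv ^^ (\<beta> - k)) f x))\<bar>
        \<le> (\<beta> choose k) * M k"
      by (simp only: abs_mult[of "real _"] abs_of_nat)
  qed
  finally show ?thesis .
qed

lemma scale_bounded_mult:
  fixes C E :: "nat \<Rightarrow> real"
  assumes "scale_bounded C u" "scale_bounded E v"
  shows "scale_bounded (\<lambda>n. \<Sum>k\<le>n. (n choose k) * (C k * E (n - k))) (\<lambda>x. u x * v x)"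
  unfolding scale_bounded_def
proof (intro conjI allI impI)
  have u: "smooth_on {0<..} u" and v: "smooth_on {0<..} v"
    using assms by (auto simp: scale_bounded_def)
  show "smooth_on {0<..} (\<lambda>x. u x * v x)" using u v by (simp add: smooth_on_mult)
  fix n and x :: real assume x: "x > 0"
  have bu: "\<bar>x ^ k * (deriv ^^ k) u x\<bar> \<le> C k" and bv: "\<bar>x ^ k * (deriv ^^ k) v x\<bar> \<le> E k" for k
    using assms x by (auto simp: scale_bounded_def)
  have "\<bar>x powi int n * (deriv ^^ n) (\<lambda>x. u x * v x) x\<bar>
      \<le> (\<Sum>k\<le>n. (n choose k) * (C k * E (n - k)))"
  proof (rule Leibniz_powi_bound[OF u v x])
    fix k assume "k \<le> n"
    then have pw: "x powi (int n - int k) = x ^ (n - k)" by (simp flip: of_nat_diff)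
    have "0 \<le> C k" using bu[of k] by linarith
    then show "(\<bar>x ^ k * (deriv ^^ k) u x\<bar>) * (\<bar>x powi (int n - int k) * (deriv ^^ (n - k)) v x\<bar>)
        \<le> C k * E (n - k)"
      unfolding pw by (intro mult_mono[OF bu bv]) simp_all
  qed
  then show "\<bar>x ^ n * (deriv ^^ n) (\<lambda>x. u x * v x) x\<bar>
      \<le> (\<Sum>k\<le>n. (n choose k) * (C k * E (n - k)))" by simp
qed

lemma scale_bounded_dilate:
  assumes u: "smooth_on UNIV u" "scale_bounded C u" and c: "c > 0"
  shows "scale_bounded C (\<lambda>x. u (c * x))"
  unfolding scale_bounded_def
proof (intro conjI allI impI)
  show "smooth_on {0<..} (\<lambda>x. u (c * x))"
    using smooth_on_subset[OF smooth_on_affine[OF u(1), of c 0]] by simp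
  fix k and x :: real assume x: "x > 0"
  have "x ^ k * (deriv ^^ k) (\<lambda>x. u (c * x)) x = (c * x) ^ k * (deriv ^^ k) u (c * x)"
    using higher_deriv_affine[OF u(1), of k c 0 x] by (simp add: power_mult_distrib)
  also have "\<bar>\<dots>\<bar> \<le> C k"
    using u(2) x c by (simp add: scale_bounded_def)
  finally show "\<bar>x ^ k * (deriv ^^ k) (\<lambda>x. u (c * x)) x\<bar> \<le> C k" .
qed

text \<open>Outside \<open>[1, 2]\<close> the step is locally constant with value \<open>0\<close> or \<open>1\<close>, and \<open>[1, 2]\<close> is
  compact.\<close>
lemma scale_bounded_step:
  assumes s: "smooth_on UNIV s" and s0: "\<And>t. t \<le> 1 \<Longrightarrow> s t = 0" and s1: "\<And>t. t \<ge> 2 \<Longrightarrow> s t = 1"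
  obtains C where "scale_bounded C s"
proof -
  have "\<exists>B. \<forall>x>0. \<bar>x ^ k * (deriv ^^ k) s x\<bar> \<le> B" for k
  proof -
    have "isCont ((deriv ^^ k) s) x" for x
      using DERIV_isCont[OF smooth_on_DERIV[OF s]] by simp
    then have "continuous_on {1..2} (\<lambda>x. x ^ k * (deriv ^^ k) s x)"
      by (intro continuous_intros continuous_at_imp_continuous_on) auto
    then have "bounded ((\<lambda>x. x ^ k * (deriv ^^ k) s x) ` {1..2})"
      by (intro compact_imp_bounded compact_continuous_image) auto
    then obtain B where B: "\<forall>x\<in>{1..2}. \<bar>x ^ k * (deriv ^^ k) s x\<bar> \<le> B"
      unfolding bounded_iff by auto
    have "\<bar>x ^ k * (deriv ^^ k) s x\<bar> \<le> max 1 B" for x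
    proof -
      consider "x < 1" | "x \<in> {1..2}" | "x > 2" by fastforce
      then show ?thesis
      proof cases
        case 1
        then show ?thesis
          using higher_deriv_locally_const[of "{..<1}" s 0 x k] s0 by (cases "k = 0") auto
      next
        case 2
        then show ?thesis using B by fastforce
      next
        case 3
        then show ?thesis
          using higher_deriv_locally_const[of "{2<..}" s 1 x k] s1 by (cases "k = 0") auto
      qed
    qed
    then show ?thesis by blast
  qed
  then obtain C where "\<forall>k. \<forall>x>0. \<bar>x ^ k * (deriv ^^ k) s x\<bar> \<le> C k" by metis
  then show ?thesis
    using that smooth_on_subset[OF s] by (simp add: scale_bounded_def)
qed

text \<open>The point is that \<open>C\<close> does not depend on \<open>r\<close>.\<close>
lemma cutoff_family_exists:
  obtains \<eta> :: "real \<Rightarrow> real \<Rightarrow> real" and C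
  where "\<And>r. r > 0 \<Longrightarrow> scale_bounded C (\<eta> r)"
    and "\<And>r x. r > 0 \<Longrightarrow> x \<notin> {1 / r .. 2 * r} \<Longrightarrow> \<eta> r x = 0"
    and "\<And>r x. r > 0 \<Longrightarrow> x \<in> {2 / r <..< r} \<Longrightarrow> \<eta> r x = 1"
proof -
  obtain s :: "real \<Rightarrow> real" where s: "smooth_on UNIV s"
    and s0: "\<And>t. t \<le> 1 \<Longrightarrow> s t = 0" and s1: "\<And>t. t \<ge> 2 \<Longrightarrow> s t = 1"
    by (rule smooth_step_exists) blast
  obtain C where C: "scale_bounded C s" using scale_bounded_step[OF s s0 s1] by blast
  let ?\<eta> = "\<lambda>r x. s (r * x) * (1 - s (1 / r * x))"
  show ?thesis
  proof (rule that[of _ ?\<eta>])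
    fix r :: real assume r: "r > 0"
    show "scale_bounded (\<lambda>n. \<Sum>k\<le>n. (n choose k) * (C k * (\<bar>1\<bar> + C (n - k)))) (?\<eta> r)"
      by (intro scale_bounded_mult scale_bounded_diff scale_bounded_const scale_bounded_dilate s C)
        (use r in auto)
    fix x
    show "?\<eta> r x = 0" if "x \<notin> {1 / r .. 2 * r}"
      using that r s0[of "r * x"] s1[of "1 / r * x"] by (auto simp: field_simps not_le)
    show "?\<eta> r x = 1" if "x \<in> {2 / r <..< r}"
      using that r s1[of "r * x"] s0[of "1 / r * x"] by (auto simp: field_simps)
  qed
qed

section \<open>Cutting off a Schwartz function\<close>

lemma Schwartz_RplusD:
  assumes "f \<in> Schwartz_Rplus"
  shows "smooth_on {0<..} f"
    and "x > 0 \<Longrightarrow> \<bar>x powi \<alpha> * (deriv ^^ \<beta>) f x\<bar> \<le> schwartz_seminorm \<alpha> \<beta> f"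
proof -
  show "smooth_on {0<..} f"
    using assms unfolding Schwartz_Rplus_def smooth_Rplus_iff by blast
  have "bdd_above ((\<lambda>x. \<bar>x powi \<alpha> * (deriv ^^ \<beta>) f x\<bar>) ` {0<..})"
    using assms unfolding Schwartz_Rplus_def mem_Collect_eq by (elim conjE allE)
  then show "x > 0 \<Longrightarrow> \<bar>x powi \<alpha> * (deriv ^^ \<beta>) f x\<bar> \<le> schwartz_seminorm \<alpha> \<beta> f"
    unfolding schwartz_seminorm_def by (intro cSUP_upper) simp
qed

lemma Schwartz_RplusI:
  assumes "\<And>x. x \<le> 0 \<Longrightarrow> f x = 0" "smooth_on {0<..} f"
    and "\<And>\<alpha> \<beta>. \<exists>K. \<forall>x>0. \<bar>x powi \<alpha> * (deriv ^^ \<beta>) f x\<bar> \<le> K"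
  shows "f \<in> Schwartz_Rplus"
proof -
  have "bdd_above ((\<lambda>x. \<bar>x powi \<alpha> * (deriv ^^ \<beta>) f x\<bar>) ` {0<..})" for \<alpha> \<beta>
  proof -
    obtain K where "\<forall>x>0. \<bar>x powi \<alpha> * (deriv ^^ \<beta>) f x\<bar> \<le> K" using assms(3) by blast
    then show ?thesis by (intro bdd_aboveI2[of _ _ K]) simp
  qed
  then show ?thesis
    using assms(1,2) unfolding Schwartz_Rplus_def smooth_Rplus_iff by blast
qed

lemma schwartz_seminorm_le:
  assumes "\<And>x. x > 0 \<Longrightarrow> \<bar>x powi \<alpha> * (deriv ^^ \<beta>) f x\<bar> \<le> K"
  shows "schwartz_seminorm \<alpha> \<beta> f \<le> K"
  unfolding schwartz_seminorm_def using assms by (intro cSUP_least) auto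

lemma Schwartz_Rplus_mult_scale_bounded:
  assumes u: "scale_bounded C u" and f: "f \<in> Schwartz_Rplus"
  shows "(\<lambda>x. u x * f x) \<in> Schwartz_Rplus"
proof (rule Schwartz_RplusI)
  show "u x * f x = 0" if "x \<le> 0" for x
    using f that unfolding Schwartz_Rplus_def by simp
  have su: "smooth_on {0<..} u" using u by (simp add: scale_bounded_def)
  note sf = Schwartz_RplusD(1)[OF f]
  show "smooth_on {0<..} (\<lambda>x. u x * f x)" using su sf by (simp add: smooth_on_mult)
  fix \<alpha> \<beta>
  have "\<bar>x powi \<alpha> * (deriv ^^ \<beta>) (\<lambda>x. u x * f x) x\<bar>
      \<le> (\<Sum>k\<le>\<beta>. (\<beta> choose k) * (C k * schwartz_seminorm (\<alpha> - int k) (\<beta> - k) f))" if x: "x > 0" for x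
  proof (rule Leibniz_powi_bound[OF su sf x])
    fix k
    have "\<bar>x ^ k * (deriv ^^ k) u x\<bar> \<le> C k" using u x by (simp add: scale_bounded_def)
    then show "(\<bar>x ^ k * (deriv ^^ k) u x\<bar>) * (\<bar>x powi (\<alpha> - int k) * (deriv ^^ (\<beta> - k)) f x\<bar>)
        \<le> C k * schwartz_seminorm (\<alpha> - int k) (\<beta> - k) f"
      by (intro mult_mono Schwartz_RplusD(2)[OF f x]) linarith+
  qed
  then show "\<exists>K. \<forall>x>0. \<bar>x powi \<alpha> * (deriv ^^ \<beta>) (\<lambda>x. u x * f x) x\<bar> \<le> K" by blast
qed

text \<open>Near \<open>0\<close> the summand \<open>1 / x\<close> is large, near infinity the summand \<open>x\<close>; this is where the
  factor \<open>2 / r\<close> in the truncation error comes from.\<close>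
lemma one_le_weight_outside_middle:
  fixes x r :: real
  assumes x: "x > 0" and r: "r > 0" and out: "x \<notin> {2 / r <..< r}"
  shows "1 \<le> (2 / r) * (x + 1 / x)"
proof -
  consider "x \<le> 2 / r" | "x \<ge> r" using out by fastforce
  then have "1 \<le> (2 / r) * (1 / x) \<or> 1 \<le> (2 / r) * x"
    using r x by cases (simp_all add: field_simps)
  moreover have "0 \<le> (2 / r) * (1 / x)" "0 \<le> (2 / r) * x" using r x by simp_all
  ultimately show ?thesis unfolding distrib_left by linarith
qed

text \<open>Multiplying by \<open>x + 1 / x\<close> shifts the exponent of the seminorm by one in either direction, and
  all integer exponents are available.\<close>
lemma weight_mult_powi:
  fixes x y :: real
  assumes x: "x > 0"
  shows "(x + 1 / x) * \<bar>x powi a * y\<bar> = \<bar>x powi (a + 1) * y\<bar> + \<bar>x powi (a - 1) * y\<bar>"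
proof -
  have "x powi (a + 1) = x * x powi a" "x powi (a - 1) = (1 / x) * x powi a"
    using x by (simp_all add: power_int_add power_int_diff)
  then have "\<bar>x powi (a + 1) * y\<bar> = x * \<bar>x powi a * y\<bar>" "\<bar>x powi (a - 1) * y\<bar> = (1 / x) * \<bar>x powi a * y\<bar>"
    using x by (simp_all only: abs_mult abs_of_pos mult.assoc zero_less_divide_1_iff)
  then show ?thesis by (simp only: distrib_right)
qed

text \<open>On the open middle interval all derivatives of \<open>w\<close> vanish; elsewhere the weight inequality buys
  the factor \<open>2 / r\<close> at the price of one power of \<open>x\<close> or \<open>1 / x\<close>, which the neighbouring
  seminorms of \<open>f\<close> absorb.\<close>
lemma seminorm_mult_le_if_vanishes_in_middle:
  assumes w: "scale_bounded C w" and f: "f \<in> Schwartz_Rplus"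
    and r: "r > 0" and w0: "\<And>x. x \<in> {2 / r <..< r} \<Longrightarrow> w x = 0" and x: "x > 0"
  shows "\<bar>x powi \<alpha> * (deriv ^^ \<beta>) (\<lambda>x. w x * f x) x\<bar>
    \<le> (\<Sum>k\<le>\<beta>. (\<beta> choose k) * (C k * (schwartz_seminorm (\<alpha> - int k + 1) (\<beta> - k) f
          + schwartz_seminorm (\<alpha> - int k - 1) (\<beta> - k) f))) * (2 / r)"
proof -
  have sw: "smooth_on {0<..} w" using w by (simp add: scale_bounded_def)
  have "\<bar>x powi \<alpha> * (deriv ^^ \<beta>) (\<lambda>x. w x * f x) x\<bar>
    \<le> (\<Sum>k\<le>\<beta>. (\<beta> choose k) * (C k * (schwartz_seminorm (\<alpha> - int k + 1) (\<beta> - k) f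
          + schwartz_seminorm (\<alpha> - int k - 1) (\<beta> - k) f) * (2 / r)))"
  proof (rule Leibniz_powi_bound[OF sw Schwartz_RplusD(1)[OF f] x])
    fix k
    let ?F = "(deriv ^^ (\<beta> - k)) f x" and ?a = "\<alpha> - int k"
    have Ck: "\<bar>x ^ k * (deriv ^^ k) w x\<bar> \<le> C k" using w x by (simp add: scale_bounded_def)
    have C0: "0 \<le> C k" by (rule order.trans[OF abs_ge_zero Ck])
    have "\<bar>x ^ k * (deriv ^^ k) w x\<bar> \<le> C k * ((2 / r) * (x + 1 / x))"
    proof (cases "x \<in> {2 / r <..< r}")
      case True
      then have "(deriv ^^ k) w x = 0"
        using higher_deriv_locally_const[OF open_greaterThanLessThan w0 True, where n = k] by simp
      moreover have "0 \<le> C k * ((2 / r) * (x + 1 / x))"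
        using C0 r x by (intro mult_nonneg_nonneg add_nonneg_nonneg) simp_all
      ultimately show ?thesis by simp
    next
      case False
      then have "1 \<le> (2 / r) * (x + 1 / x)" by (rule one_le_weight_outside_middle[OF x r])
      then have "C k * 1 \<le> C k * ((2 / r) * (x + 1 / x))" by (rule mult_left_mono[OF _ C0])
      then show ?thesis using order.trans[OF Ck] by simp
    qed
    then have "(\<bar>x ^ k * (deriv ^^ k) w x\<bar>) * (\<bar>x powi ?a * ?F\<bar>)
        \<le> C k * ((2 / r) * (x + 1 / x)) * (\<bar>x powi ?a * ?F\<bar>)"
      by (rule mult_right_mono) simp
    also have "\<dots> = C k * (2 / r) * ((x + 1 / x) * \<bar>x powi ?a * ?F\<bar>)"
      by (simp only: mult.assoc)
    also have "\<dots> \<le> C k * (2 / r) * (schwartz_seminorm (?a + 1) (\<beta> - k) f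
        + schwartz_seminorm (?a - 1) (\<beta> - k) f)"
    proof (rule mult_left_mono)
      show "(x + 1 / x) * \<bar>x powi ?a * ?F\<bar>
          \<le> schwartz_seminorm (?a + 1) (\<beta> - k) f + schwartz_seminorm (?a - 1) (\<beta> - k) f"
        unfolding weight_mult_powi[OF x] by (rule add_mono[OF Schwartz_RplusD(2,2)[OF f x]])
      show "0 \<le> C k * (2 / r)" using C0 r by simp
    qed
    also have "\<dots> = C k * (schwartz_seminorm (?a + 1) (\<beta> - k) f
        + schwartz_seminorm (?a - 1) (\<beta> - k) f) * (2 / r)"
      by (simp only: mult.assoc mult.commute[of _ "2 / r"])
    finally show "(\<bar>x ^ k * (deriv ^^ k) w x\<bar>) * (\<bar>x powi ?a * ?F\<bar>)
        \<le> C k * (schwartz_seminorm (?a + 1) (\<beta> - k) f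
        + schwartz_seminorm (?a - 1) (\<beta> - k) f) * (2 / r)" .
  qed
  also have "\<dots> = (\<Sum>k\<le>\<beta>. (\<beta> choose k) * (C k * (schwartz_seminorm (\<alpha> - int k + 1) (\<beta> - k) f
          + schwartz_seminorm (\<alpha> - int k - 1) (\<beta> - k) f))) * (2 / r)"
    unfolding sum_distrib_right by (rule sum.cong[OF refl]) (rule mult.assoc[symmetric])
  finally show ?thesis .
qed

text \<open>Since \<open>a > 0\<close>, the closure relative to \<open>(0,\<infinity>)\<close> is the closure in the real line.\<close>
lemma compact_supp_Rplus:
  assumes "0 < a" "\<And>x. x \<notin> {a..b} \<Longrightarrow> f x = 0"
  shows "compact (supp_Rplus f)"
proof -
  let ?A = "{x \<in> {0<..}. f x \<noteq> 0}"
  have A: "?A \<subseteq> {a..b}" using assms(2) by blast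
  then have cl: "closure ?A \<subseteq> {a..b}" by (rule closure_minimal) simp
  have "supp_Rplus f = {0<..} \<inter> closure ?A"
    unfolding supp_Rplus_def closure_of_subtopology by (simp add: Int_absorb1 Collect_mono_iff subset_iff)
  also have "\<dots> = closure ?A" using cl assms(1) by fastforce
  finally show ?thesis
    using bounded_subset[OF bounded_closed_interval A] by (simp add: compact_closure)
qed

lemma Schwartz_Rplus_approx_by_compact_support:
  assumes f: "f \<in> Schwartz_Rplus"
  obtains g :: "real \<Rightarrow> real \<Rightarrow> real"
  where "\<And>r. r > 0 \<Longrightarrow> g r \<in> Schwartz_c_Rplus"
    and "\<And>\<alpha> \<beta>. \<exists>K. \<forall>r>0. \<forall>x>0. \<bar>x powi \<alpha> * (deriv ^^ \<beta>) (\<lambda>y. g r y - f y) x\<bar> \<le> K / r"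
proof -
  obtain \<eta> :: "real \<Rightarrow> real \<Rightarrow> real" and C where \<eta>: "\<And>r. r > 0 \<Longrightarrow> scale_bounded C (\<eta> r)"
    and \<eta>0: "\<And>r x. r > 0 \<Longrightarrow> x \<notin> {1 / r .. 2 * r} \<Longrightarrow> \<eta> r x = 0"
    and \<eta>1: "\<And>r x. r > 0 \<Longrightarrow> x \<in> {2 / r <..< r} \<Longrightarrow> \<eta> r x = 1"
    by (rule cutoff_family_exists) blast
  show ?thesis
  proof (rule that[of "\<lambda>r x. \<eta> r x * f x"])
    fix r :: real assume r: "r > 0"
    have "compact (supp_Rplus (\<lambda>x. \<eta> r x * f x))"
      by (rule compact_supp_Rplus[of "1 / r" "2 * r"]) (use r \<eta>0 in auto)
    then show "(\<lambda>x. \<eta> r x * f x) \<in> Schwartz_c_Rplus"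
      using Schwartz_Rplus_mult_scale_bounded[OF \<eta>[OF r] f] by (simp add: Schwartz_c_Rplus_def)
  next
    fix \<alpha> \<beta>
    have eq: "(\<lambda>y. \<eta> r y * f y - f y) = (\<lambda>y. (\<eta> r y - 1) * f y)" for r
      by (simp add: left_diff_distrib)
    \<comment> \<open>The summand \<open>\<bar>1\<bar>\<close> is the bound of the constant subtracted from the cutoff.\<close>
    define K where "K = (\<Sum>k\<le>\<beta>. (\<beta> choose k) * ((C k + \<bar>1\<bar>) *
      (schwartz_seminorm (\<alpha> - int k + 1) (\<beta> - k) f + schwartz_seminorm (\<alpha> - int k - 1) (\<beta> - k) f)))"
    have "\<bar>x powi \<alpha> * (deriv ^^ \<beta>) (\<lambda>y. \<eta> r y * f y - f y) x\<bar> \<le> K * (2 / r)"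
      if "r > 0" "x > 0" for r x
      unfolding eq K_def
      by (rule seminorm_mult_le_if_vanishes_in_middle[OF scale_bounded_diff[OF \<eta> scale_bounded_const] f])
        (use that \<eta>1 in auto)
    then show "\<exists>K. \<forall>r>0. \<forall>x>0. \<bar>x powi \<alpha> * (deriv ^^ \<beta>) (\<lambda>y. \<eta> r y * f y - f y) x\<bar> \<le> K / r"
      by (intro exI[of _ "K * 2"]) simp
  qed
qed

section \<open>Density\<close>

text \<open>Induction over the generated topology reduces the claim to a semiball. Its centre \<open>f0\<close> need not
  be the limit \<open>f\<close>; the triangle inequality leaves the positive margin \<open>e - d\<close>, where \<open>d\<close> is the
  seminorm of \<open>f - f0\<close>.\<close>
lemma eventually_in_open_Schwartz_Rplus:
  fixes g :: "real \<Rightarrow> real \<Rightarrow> real"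
  assumes f: "f \<in> Schwartz_Rplus" and g: "\<And>r. r > 0 \<Longrightarrow> g r \<in> Schwartz_Rplus"
    and K: "\<And>\<alpha> \<beta>. \<exists>K. \<forall>r>0. \<forall>x>0. \<bar>x powi \<alpha> * (deriv ^^ \<beta>) (\<lambda>y. g r y - f y) x\<bar> \<le> K / r"
    and U: "openin Schwartz_Rplus_topology U" "f \<in> U"
  shows "\<forall>\<^sub>F r in at_top. g r \<in> U"
proof -
  have "generate_topology_on {{g \<in> Schwartz_Rplus. schwartz_seminorm \<alpha> \<beta> (\<lambda>x. g x - f x) < e} | \<alpha> \<beta> f e.
        f \<in> Schwartz_Rplus \<and> e > 0} U"
    using U(1) by (simp add: Schwartz_Rplus_topology_def openin_topology_generated_by_iff)
  then show ?thesis using U(2)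
  proof (induction rule: generate_topology_on.induct)
    case Empty
    then show ?case by simp
  next
    case (Int A B)
    then show ?case by (auto intro: eventually_conj)
  next
    case (UN \<K>)
    then obtain A where "A \<in> \<K>" "f \<in> A" by blast
    then have "\<forall>\<^sub>F r in at_top. g r \<in> A" using UN by blast
    then show ?case by (rule eventually_mono) (use \<open>A \<in> \<K>\<close> in blast)
  next
    case (Basis V)
    then obtain \<alpha> \<beta> f0 e where f0: "f0 \<in> Schwartz_Rplus"
      and V: "V = {g \<in> Schwartz_Rplus. schwartz_seminorm \<alpha> \<beta> (\<lambda>x. g x - f0 x) < e}" by blast
    define d where "d = schwartz_seminorm \<alpha> \<beta> (\<lambda>x. f x - f0 x)"
    have d: "d < e" using Basis V by (simp add: d_def)
    have diff: "(deriv ^^ \<beta>) (\<lambda>y. h y - h' y) x = (deriv ^^ \<beta>) h x - (deriv ^^ \<beta>) h' x"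
      if "h \<in> Schwartz_Rplus" "h' \<in> Schwartz_Rplus" "x > 0" for h h' x
      using that by (intro higher_deriv_diff[of "{0<..}"]) (auto dest: Schwartz_RplusD(1))
    have "bdd_above ((\<lambda>x. \<bar>x powi \<alpha> * (deriv ^^ \<beta>) (\<lambda>y. f y - f0 y) x\<bar>) ` {0<..})"
    proof (rule bdd_aboveI2)
      fix x :: real assume "x \<in> {0<..}"
      then show "\<bar>x powi \<alpha> * (deriv ^^ \<beta>) (\<lambda>y. f y - f0 y) x\<bar>
          \<le> schwartz_seminorm \<alpha> \<beta> f + schwartz_seminorm \<alpha> \<beta> f0"
        using Schwartz_RplusD(2)[OF f, of x \<alpha> \<beta>] Schwartz_RplusD(2)[OF f0, of x \<alpha> \<beta>]
        by (simp add: diff f f0 right_diff_distrib)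
    qed
    then have le_d: "\<bar>x powi \<alpha> * (deriv ^^ \<beta>) (\<lambda>y. f y - f0 y) x\<bar> \<le> d" if "x > 0" for x
      unfolding d_def schwartz_seminorm_def using that by (intro cSUP_upper) auto
    obtain K where K: "\<And>r x. r > 0 \<Longrightarrow> x > 0 \<Longrightarrow>
        \<bar>x powi \<alpha> * (deriv ^^ \<beta>) (\<lambda>y. g r y - f y) x\<bar> \<le> K / r"
      using K by blast
    have "((\<lambda>r. K / r) \<longlongrightarrow> 0) at_top"
      by (intro real_tendsto_divide_at_top[OF tendsto_const] filterlim_ident)
    then have "\<forall>\<^sub>F r in at_top. K / r < e - d"
      using d by (intro order_tendstoD(2)) auto
    then show ?case using eventually_gt_at_top[of 0]
    proof eventually_elim
      case (elim r)
      have "schwartz_seminorm \<alpha> \<beta> (\<lambda>x. g r x - f0 x) \<le> K / r + d"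
      proof (rule schwartz_seminorm_le)
        fix x :: real assume x: "x > 0"
        show "\<bar>x powi \<alpha> * (deriv ^^ \<beta>) (\<lambda>x. g r x - f0 x) x\<bar> \<le> K / r + d"
          using K[OF elim(2) x] le_d[OF x] x elim(2) by (simp add: diff f f0 g right_diff_distrib)
      qed
      then show ?case using V g elim by simp
    qed
  qed
qed

theorem theorem7:
  shows "Schwartz_Rplus_topology closure_of Schwartz_c_Rplus = Schwartz_Rplus"
proof (rule antisym)
  show "Schwartz_Rplus_topology closure_of Schwartz_c_Rplus \<subseteq> Schwartz_Rplus"
    using closure_of_subset_topspace[of Schwartz_Rplus_topology] by simp
  show "Schwartz_Rplus \<subseteq> Schwartz_Rplus_topology closure_of Schwartz_c_Rplus"
  proof
    fix f assume f: "f \<in> Schwartz_Rplus"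
    obtain g :: "real \<Rightarrow> real \<Rightarrow> real" where g: "\<And>r. r > 0 \<Longrightarrow> g r \<in> Schwartz_c_Rplus"
      and K: "\<And>\<alpha> \<beta>. \<exists>K. \<forall>r>0. \<forall>x>0. \<bar>x powi \<alpha> * (deriv ^^ \<beta>) (\<lambda>y. g r y - f y) x\<bar> \<le> K / r"
      using Schwartz_Rplus_approx_by_compact_support[OF f] by blast
    have gS: "g r \<in> Schwartz_Rplus" if "r > 0" for r
      using g[OF that] by (simp add: Schwartz_c_Rplus_def)
    have "\<exists>h\<in>Schwartz_c_Rplus. h \<in> U" if U: "f \<in> U" "openin Schwartz_Rplus_topology U" for U
    proof -
      have "\<forall>\<^sub>F r in at_top. g r \<in> U \<and> r > 0"
        by (intro eventually_conj eventually_in_open_Schwartz_Rplus[OF f gS K U(2,1)]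
            eventually_gt_at_top)
      then obtain r where "g r \<in> U" "r > 0"
        using eventually_happens[of _ "at_top :: real filter"] by auto
      then show ?thesis using g by blast
    qed
    then show "f \<in> Schwartz_Rplus_topology closure_of Schwartz_c_Rplus"
      using f unfolding in_closure_of by auto
  qed
qed

end
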